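(* Let $n,m,k,\lambda$ be positive integers with $k>1$ and $k\mid n$. Then there does not exist an $(n,m,k,\lambda)$-SEDF (over any finite abelian group of order $n$).
   Context: Let $G$ be a finite abelian group of order $n$, written multiplicatively, with identity $e$. For nonempty subsets $A_1,A_2\subseteq G$, let $\Delta_E(A_1,A_2)$ be the multiset $\{xy^{-1} : x\in A_1,\ y\in A_2\}$. Let $k,\lambda,m$ be positive integers. An $(n,m,k,\lambda)$-strong external difference family (SEDF) over $G$ is a collection $\{A_1,\dots,A_m\}$ of pairwise disjoint $k$-element subsets of $G$ such that for each $1\le j\le m$ the multiset union $\bigcup_{\ell\neq j}\Delta_E(A_\ell,A_j)$ equals $\lambda(G\setminus\{e\})$, i.e. contains every non-identity element of $G$ exactly $\lambda$ times and does not contain $e$. *)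

theory Defs
  imports "HOL-Algebra.Group" "HOL-Algebra.Coset" "HOL-Library.Multiset" "HOL-Library.Disjoint_Sets"
begin

definition ext_diff ::
  "('a, 'b) monoid_scheme \<Rightarrow> 'a set \<Rightarrow> 'a set \<Rightarrow> 'a multiset" where
  "ext_diff G A B = image_mset (\<lambda>(x, y). x \<otimes>\<^bsub>G\<^esub> inv\<^bsub>G\<^esub> y) (mset_set (A \<times> B))"

text \<open>The blocks are indexed by \<open>1, \<dots>, m\<close>; only these values of \<open>A\<close> are constrained.
  The multiset union over \<open>l \<noteq> j\<close> adds multiplicities, so it is a sum of multisets (and not
  the join \<open>\<union>#\<close>, which takes the maximum).\<close>

definition is_SEDF ::
  "('a, 'b) monoid_scheme \<Rightarrow> nat \<Rightarrow> nat \<Rightarrow> nat \<Rightarrow> nat \<Rightarrow> (nat \<Rightarrow> 'a set) \<Rightarrow> bool" where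
  "is_SEDF G n m k lam A \<longleftrightarrow>
     comm_group G \<and> finite (carrier G) \<and> order G = n \<and>
     0 < m \<and> 0 < k \<and> 0 < lam \<and>
     (\<forall>j\<in>{1..m}. A j \<subseteq> carrier G \<and> card (A j) = k) \<and>
     disjoint_family_on A {1..m} \<and>
     (\<forall>j\<in>{1..m}. (\<Sum>l\<in>{1..m} - {j}. ext_diff G (A l) (A j)) =
        repeat_mset lam (mset_set (carrier G - {\<one>\<^bsub>G\<^esub>})))"

end

theory Submission
  imports Defs
begin

text \<open>Counting one multiset equation gives \<open>k\<^sup>2 (m - 1) = \<lambda> (n - 1)\<close>. Since \<open>k\<close> divides \<open>n\<close>, it
  is coprime to \<open>n - 1\<close>, so \<open>k\<^sup>2\<close> divides \<open>\<lambda>\<close> and hence \<open>m \<ge> n\<close>. But \<open>m\<close> disjoint blocks of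
  size \<open>k > 1\<close> do not fit into a group of order \<open>n\<close> then.\<close>

lemma size_ext_diff: "size (ext_diff G A B) = card A * card B"
  by (simp add: ext_diff_def card_cartesian_product)

lemma SEDF_count:
  assumes "is_SEDF G n m k lam A"
  shows "k\<^sup>2 * (m - 1) = lam * (n - 1)"
proof -
  interpret comm_group G
    using assms by (simp add: is_SEDF_def)
  have fin: "finite (carrier G)" and ord: "order G = n" and "1 \<in> {1..m}"
    and card_A: "\<And>j. j \<in> {1..m} \<Longrightarrow> card (A j) = k"
    using assms by (simp_all add: is_SEDF_def)
  \<comment> \<open>Any block would serve as the fixed one; index 1 exists because
    \<open>0 < m\<close>. Comparing sizes turns the multiset equation into the numerical
    one.\<close>
  have "(\<Sum>l\<in>{1..m} - {1}. ext_diff G (A l) (A 1)) =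
      repeat_mset lam (mset_set (carrier G - {\<one>\<^bsub>G\<^esub>}))"
    using assms \<open>1 \<in> {1..m}\<close> unfolding is_SEDF_def by blast
  then have "size (\<Sum>l\<in>{1..m} - {1}. ext_diff G (A l) (A 1)) =
      size (repeat_mset lam (mset_set (carrier G - {\<one>\<^bsub>G\<^esub>})))"
    by (rule arg_cong)
  moreover have "size (\<Sum>l\<in>{1..m} - {1}. ext_diff G (A l) (A 1)) = (\<Sum>l\<in>{1..m} - {1}. k * k)"
    unfolding size_multiset_sum
    using card_A \<open>1 \<in> {1..m}\<close> by (intro sum.cong) (auto simp: size_ext_diff)
  moreover have "card (carrier G - {\<one>\<^bsub>G\<^esub>}) = n - 1"
    using fin ord by (simp add: order_def)
  ultimately show ?thesis
    using \<open>1 \<in> {1..m}\<close> by (simp add: power2_eq_square mult.commute)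
qed

text \<open>The blocks are pairwise disjoint inside the finite carrier, so their sizes add up to at
  most the group order.\<close>

lemma SEDF_blocks_le:
  assumes "is_SEDF G n m k lam A"
  shows "m * k \<le> n"
proof -
  have fin: "finite (carrier G)" and ord: "order G = n"
    and sub: "\<And>j. j \<in> {1..m} \<Longrightarrow> A j \<subseteq> carrier G"
    and card_A: "\<And>j. j \<in> {1..m} \<Longrightarrow> card (A j) = k"
    and disj: "disjoint_family_on A {1..m}"
    using assms by (simp_all add: is_SEDF_def)
  have fin_A: "finite (A j)" if "j \<in> {1..m}" for j
    using sub [OF that] fin by (rule finite_subset)
  have "card (\<Union>j\<in>{1..m}. A j) = (\<Sum>j\<in>{1..m}. card (A j))"
    using fin_A disj by (intro card_UN_disjoint) (auto simp: disjoint_family_on_def)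
  also have "\<dots> = m * k"
    using card_A by simp
  finally have "m * k = card (\<Union>j\<in>{1..m}. A j)" ..
  also have "\<dots> \<le> card (carrier G)"
    using sub fin by (intro card_mono UN_least)
  finally show ?thesis
    using ord by (simp add: order_def)
qed

theorem lemma1p7:
  fixes G :: "('a, 'b) monoid_scheme"
    and n m k lam :: nat
  assumes "0 < n" and "0 < m" and "0 < k" and "0 < lam"
    and "1 < k" and "k dvd n"
    and "comm_group G" and "finite (carrier G)" and "order G = n"
  shows "\<not> (\<exists>A :: nat \<Rightarrow> 'a set. is_SEDF G n m k lam A)"
proof
  assume "\<exists>A :: nat \<Rightarrow> 'a set. is_SEDF G n m k lam A"
  then obtain A :: "nat \<Rightarrow> 'a set" where A: "is_SEDF G n m k lam A" ..
  have count: "k\<^sup>2 * (m - 1) = lam * (n - 1)"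
    using A by (rule SEDF_count)
  \<comment> \<open>\<open>0 < n\<close> matters: with truncated subtraction, \<open>n = 0\<close>
    would give the pair 0, 0, which is not coprime.\<close>
  have "coprime n (n - 1)"
    using \<open>0 < n\<close> by (rule coprime_diff_one_right_nat)
  then have "coprime (k\<^sup>2) (n - 1)"
    using \<open>k dvd n\<close> by (simp add: coprime_divisors [OF _ dvd_refl])
  moreover have "k\<^sup>2 dvd lam * (n - 1)"
    unfolding count [symmetric] by (rule dvd_triv_left)
  ultimately have "k\<^sup>2 dvd lam"
    by (simp add: coprime_dvd_mult_left_iff)
  then have "k\<^sup>2 \<le> lam"
    using \<open>0 < lam\<close> by (rule dvd_imp_le)
  \<comment> \<open>By \<open>count\<close> the right side is \<open>lam * (n - 1)\<close>.
    Cancelling the square then leaves \<open>n - 1 \<le> m - 1\<close>, and \<open>0 < m\<close>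
    lifts this to \<open>n \<le> m\<close>.\<close>
  then have "k\<^sup>2 * (n - 1) \<le> k\<^sup>2 * (m - 1)"
    unfolding count by (rule mult_le_mono1)
  then have "n \<le> m"
    using \<open>0 < k\<close> \<open>0 < m\<close> by simp
  \<comment> \<open>The strict link of the cycle \<open>n \<le> m < m * k \<le> n\<close>; for
    \<open>k = 1\<close> it would be an equality.\<close>
  also have "m < m * k"
    using \<open>0 < m\<close> \<open>1 < k\<close> by simp
  also have "m * k \<le> n"
    using A by (rule SEDF_blocks_le)
  finally show False
    by simp
qed

end
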